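(* Let $R$ be a commutative Noetherian ring of prime characteristic $p$. If $R$ has a test element $c$ for ideals, then $R$ satisfies condition $(R_0)$, that is, $R_{\mathfrak{p}}$ is a field for every minimal prime ideal $\mathfrak{p}$ of $R$.
   Context: $R^{\circ}$ is the complement in $R$ of the union of the minimal prime ideals of $R$; $\mathbb{N}_0$ is the set of non-negative integers. For an ideal $\mathfrak{b}$ of $R$ and $n\in\mathbb{N}_0$, $\mathfrak{b}^{[p^n]}$ is the ideal generated by all $p^n$th powers of elements of $\mathfrak{b}$, and the tight closure $\mathfrak{b}^*$ is the set of $r\in R$ for which there exists $d\in R^{\circ}$ with $dr^{p^n}\in\mathfrak{b}^{[p^n]}$ for all $n\gg 0$. A test element for ideals for $R$ is an element $c\in R^{\circ}$ such that, for every ideal $\mathfrak{b}$ of $R$ and every $r\in\mathfrak{b}^*$, one has $cr^{p^n}\in\mathfrak{b}^{[p^n]}$ for all $n\in\mathbb{N}_0$. *)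

theory Defs
  imports "HOL-Computational_Algebra.Primes" "HOL-Algebra.Ring_Divisibility"
begin

section \<open>Characteristic and minimal primes\<close>

definition ring_characteristic :: "('a, 'b) ring_scheme \<Rightarrow> nat"
  where "ring_characteristic R =
    (if \<exists>n::nat. n > 0 \<and> [n] \<cdot>\<^bsub>R\<^esub> \<one>\<^bsub>R\<^esub> = \<zero>\<^bsub>R\<^esub>
     then LEAST n::nat. n > 0 \<and> [n] \<cdot>\<^bsub>R\<^esub> \<one>\<^bsub>R\<^esub> = \<zero>\<^bsub>R\<^esub> else 0)"

definition minimal_prime_ideal :: "'a set \<Rightarrow> ('a, 'b) ring_scheme \<Rightarrow> bool"
  where "minimal_prime_ideal P R \<longleftrightarrow>
    primeideal P R \<and> (\<forall>Q. primeideal Q R \<longrightarrow> Q \<subseteq> P \<longrightarrow> Q = P)"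

definition ring_circ :: "('a, 'b) ring_scheme \<Rightarrow> 'a set"
  where "ring_circ R = carrier R - \<Union>{P. minimal_prime_ideal P R}"


section \<open>Localization\<close>

text \<open>The fraction \<open>r / s\<close> is represented by its equivalence class of pairs (numerator,
  denominator). The factor \<open>t\<close> is needed because the ring may have zero divisors.\<close>

definition loc_frac :: "('a, 'b) ring_scheme \<Rightarrow> 'a set \<Rightarrow> 'a \<Rightarrow> 'a \<Rightarrow> ('a \<times> 'a) set"
  where "loc_frac R S r s = {(r', s'). r' \<in> carrier R \<and> s' \<in> S \<and>
    (\<exists>t\<in>S. t \<otimes>\<^bsub>R\<^esub> (s' \<otimes>\<^bsub>R\<^esub> r \<ominus>\<^bsub>R\<^esub> s \<otimes>\<^bsub>R\<^esub> r') = \<zero>\<^bsub>R\<^esub>)}"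

text \<open>The unions below run over all representatives; as the result does not depend on the
  representative (\<open>loc_mult\<close> and \<open>loc_add\<close> below), each is a single class. As for
  \<^const>\<open>FactRing\<close>, the operations are meaningful only on the carrier.\<close>

definition localization :: "('a, 'b) ring_scheme \<Rightarrow> 'a set \<Rightarrow> ('a \<times> 'a) set ring"
  where "localization R S =
    \<lparr>carrier = {loc_frac R S r s | r s. r \<in> carrier R \<and> s \<in> S},
     mult = (\<lambda>A B. \<Union>{loc_frac R S (a \<otimes>\<^bsub>R\<^esub> b) (s \<otimes>\<^bsub>R\<^esub> t) | a s b t.
       (a, s) \<in> A \<and> (b, t) \<in> B}),
     one = loc_frac R S \<one>\<^bsub>R\<^esub> \<one>\<^bsub>R\<^esub>,
     zero = loc_frac R S \<zero>\<^bsub>R\<^esub> \<one>\<^bsub>R\<^esub>,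
     add = (\<lambda>A B. \<Union>{loc_frac R S (t \<otimes>\<^bsub>R\<^esub> a \<oplus>\<^bsub>R\<^esub> s \<otimes>\<^bsub>R\<^esub> b) (s \<otimes>\<^bsub>R\<^esub> t) | a s b t.
       (a, s) \<in> A \<and> (b, t) \<in> B})\<rparr>"

definition localization_at :: "('a, 'b) ring_scheme \<Rightarrow> 'a set \<Rightarrow> ('a \<times> 'a) set ring"
  where "localization_at R P = localization R (carrier R - P)"

lemma (in primeideal) compl_submonoid: "submonoid (carrier R - I) R"
proof
  show "\<one> \<in> carrier R - I"
    using I_notcarr one_imp_carrier by auto
qed (use I_prime in auto)

locale mult_closed = cring R + submonoid S R for S and R (structure)
begin

lemma in_carr: "s \<in> S \<Longrightarrow> s \<in> carrier R"
  using subset by auto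

lemma loc_rel_iff:
  assumes "a \<in> carrier R" "b \<in> carrier R" "t \<in> carrier R"
  shows "t \<otimes> (a \<ominus> b) = \<zero> \<longleftrightarrow> t \<otimes> a = t \<otimes> b"
proof -
  have "t \<otimes> (a \<ominus> b) = t \<otimes> a \<ominus> t \<otimes> b"
    using assms by algebra
  then show ?thesis
    using assms r_right_minus_eq by auto
qed

lemma loc_frac_iff:
  assumes "r \<in> carrier R" "s \<in> S"
  shows "(r', s') \<in> loc_frac R S r s \<longleftrightarrow>
    r' \<in> carrier R \<and> s' \<in> S \<and> (\<exists>t\<in>S. t \<otimes> (s' \<otimes> r) = t \<otimes> (s \<otimes> r'))"
  unfolding loc_frac_def using assms in_carr by (auto simp: loc_rel_iff)

lemma loc_frac_self:
  assumes "r \<in> carrier R" "s \<in> S"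
  shows "(r, s) \<in> loc_frac R S r s"
  using assms one_closed by (auto simp: loc_frac_iff)

lemma loc_frac_mono:
  assumes "r \<in> carrier R" "s \<in> S" and 1: "(r', s') \<in> loc_frac R S r s"
  shows "loc_frac R S r' s' \<subseteq> loc_frac R S r s"
proof clarify
  fix a b assume 2: "(a, b) \<in> loc_frac R S r' s'"
  obtain t where c: "r' \<in> carrier R" "s' \<in> S" and t: "t \<in> S"
    and e1: "t \<otimes> (s' \<otimes> r) = t \<otimes> (s \<otimes> r')"
    using 1 assms(1,2) by (auto simp: loc_frac_iff)
  obtain u where d: "a \<in> carrier R" "b \<in> S" and u: "u \<in> S"
    and e2: "u \<otimes> (b \<otimes> r') = u \<otimes> (s' \<otimes> a)"
    using 2 c by (auto simp: loc_frac_iff)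
  note cs = assms(1) c(1) d(1) assms(2)[THEN in_carr] c(2)[THEN in_carr] d(2)[THEN in_carr]
    t[THEN in_carr] u[THEN in_carr]
  have "(t \<otimes> u \<otimes> s') \<otimes> (b \<otimes> r) = u \<otimes> b \<otimes> (t \<otimes> (s' \<otimes> r))"
    using cs by algebra
  also have "\<dots> = t \<otimes> s \<otimes> (u \<otimes> (b \<otimes> r'))"
    unfolding e1 using cs by algebra
  also have "\<dots> = (t \<otimes> u \<otimes> s') \<otimes> (s \<otimes> a)"
    unfolding e2 using cs by algebra
  finally show "(a, b) \<in> loc_frac R S r s"
    using assms c d t u by (auto simp: loc_frac_iff intro!: bexI[of _ "t \<otimes> u \<otimes> s'"])
qed

lemma loc_frac_sym:
  assumes "r \<in> carrier R" "s \<in> S" "(r', s') \<in> loc_frac R S r s"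
  shows "(r, s) \<in> loc_frac R S r' s'"
proof -
  obtain t where "r' \<in> carrier R" "s' \<in> S" "t \<in> S" "t \<otimes> (s' \<otimes> r) = t \<otimes> (s \<otimes> r')"
    using assms by (auto simp: loc_frac_iff)
  then show ?thesis
    using assms by (auto simp: loc_frac_iff intro!: bexI[of _ t])
qed

lemma loc_frac_eqI:
  assumes "r \<in> carrier R" "s \<in> S" "(r', s') \<in> loc_frac R S r s"
  shows "loc_frac R S r' s' = loc_frac R S r s"
proof -
  have "r' \<in> carrier R" "s' \<in> S"
    using assms by (auto simp: loc_frac_iff)
  then show ?thesis
    using assms by (meson loc_frac_mono loc_frac_sym subset_antisym)
qed

lemma loc_frac_eq_iff:
  assumes "r \<in> carrier R" "s \<in> S" "r' \<in> carrier R" "s' \<in> S"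
  shows "loc_frac R S r s = loc_frac R S r' s' \<longleftrightarrow>
    (\<exists>t\<in>S. t \<otimes> (s' \<otimes> r \<ominus> s \<otimes> r') = \<zero>)"
proof -
  have "loc_frac R S r s = loc_frac R S r' s' \<longleftrightarrow> (r', s') \<in> loc_frac R S r s"
    using assms by (metis loc_frac_eqI loc_frac_self)
  then show ?thesis
    using assms by (simp add: loc_frac_def)
qed

lemma loc_mult:
  assumes r: "r \<in> carrier R" "s \<in> S" and r': "r' \<in> carrier R" "s' \<in> S"
  shows "loc_frac R S r s \<otimes>\<^bsub>localization R S\<^esub> loc_frac R S r' s' = loc_frac R S (r \<otimes> r') (s \<otimes> s')"
proof -
  have *: "loc_frac R S (a \<otimes> b) (u \<otimes> v) = loc_frac R S (r \<otimes> r') (s \<otimes> s')"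
    if 1: "(a, u) \<in> loc_frac R S r s" and 2: "(b, v) \<in> loc_frac R S r' s'" for a u b v
  proof -
    obtain t where c: "a \<in> carrier R" "u \<in> S" and t: "t \<in> S"
      and e1: "t \<otimes> (u \<otimes> r) = t \<otimes> (s \<otimes> a)"
      using 1 r by (auto simp: loc_frac_iff)
    obtain w where d: "b \<in> carrier R" "v \<in> S" and w: "w \<in> S"
      and e2: "w \<otimes> (v \<otimes> r') = w \<otimes> (s' \<otimes> b)"
      using 2 r' by (auto simp: loc_frac_iff)
    note cs = r(1) r'(1) c(1) d(1) r(2)[THEN in_carr] r'(2)[THEN in_carr] c(2)[THEN in_carr]
      d(2)[THEN in_carr] t[THEN in_carr] w[THEN in_carr]
    have "(t \<otimes> w) \<otimes> ((u \<otimes> v) \<otimes> (r \<otimes> r')) = (t \<otimes> (u \<otimes> r)) \<otimes> (w \<otimes> (v \<otimes> r'))"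
      using cs by algebra
    also have "\<dots> = (t \<otimes> w) \<otimes> ((s \<otimes> s') \<otimes> (a \<otimes> b))"
      unfolding e1 e2 using cs by algebra
    finally have "(a \<otimes> b, u \<otimes> v) \<in> loc_frac R S (r \<otimes> r') (s \<otimes> s')"
      using r r' c d t w by (auto simp: loc_frac_iff intro!: bexI[of _ "t \<otimes> w"])
    then show ?thesis
      using r r' by (intro loc_frac_eqI) auto
  qed
  have "{loc_frac R S (a \<otimes> b) (u \<otimes> v) | a u b v.
      (a, u) \<in> loc_frac R S r s \<and> (b, v) \<in> loc_frac R S r' s'} = {loc_frac R S (r \<otimes> r') (s \<otimes> s')}"
    (is "?A = {?c}")
  proof
    show "?A \<subseteq> {?c}"
      using * by blast
    have "?c \<in> ?A"
      using loc_frac_self[OF r] loc_frac_self[OF r'] by blast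
    then show "{?c} \<subseteq> ?A"
      by blast
  qed
  then show ?thesis
    by (simp add: localization_def)
qed

lemma loc_add:
  assumes r: "r \<in> carrier R" "s \<in> S" and r': "r' \<in> carrier R" "s' \<in> S"
  shows "loc_frac R S r s \<oplus>\<^bsub>localization R S\<^esub> loc_frac R S r' s' =
    loc_frac R S (s' \<otimes> r \<oplus> s \<otimes> r') (s \<otimes> s')"
proof -
  have *: "loc_frac R S (v \<otimes> a \<oplus> u \<otimes> b) (u \<otimes> v) = loc_frac R S (s' \<otimes> r \<oplus> s \<otimes> r') (s \<otimes> s')"
    if 1: "(a, u) \<in> loc_frac R S r s" and 2: "(b, v) \<in> loc_frac R S r' s'" for a u b v
  proof -
    obtain t where c: "a \<in> carrier R" "u \<in> S" and t: "t \<in> S"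
      and e1: "t \<otimes> (u \<otimes> r) = t \<otimes> (s \<otimes> a)"
      using 1 r by (auto simp: loc_frac_iff)
    obtain w where d: "b \<in> carrier R" "v \<in> S" and w: "w \<in> S"
      and e2: "w \<otimes> (v \<otimes> r') = w \<otimes> (s' \<otimes> b)"
      using 2 r' by (auto simp: loc_frac_iff)
    note cs = r(1) r'(1) c(1) d(1) r(2)[THEN in_carr] r'(2)[THEN in_carr] c(2)[THEN in_carr]
      d(2)[THEN in_carr] t[THEN in_carr] w[THEN in_carr]
    have "(t \<otimes> w) \<otimes> ((u \<otimes> v) \<otimes> (s' \<otimes> r \<oplus> s \<otimes> r'))
        = w \<otimes> v \<otimes> s' \<otimes> (t \<otimes> (u \<otimes> r)) \<oplus> t \<otimes> u \<otimes> s \<otimes> (w \<otimes> (v \<otimes> r'))"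
      using cs by algebra
    also have "\<dots> = (t \<otimes> w) \<otimes> ((s \<otimes> s') \<otimes> (v \<otimes> a \<oplus> u \<otimes> b))"
      unfolding e1 e2 using cs by algebra
    finally have "(v \<otimes> a \<oplus> u \<otimes> b, u \<otimes> v) \<in> loc_frac R S (s' \<otimes> r \<oplus> s \<otimes> r') (s \<otimes> s')"
      using cs r r' c d t w by (auto simp: loc_frac_iff intro!: bexI[of _ "t \<otimes> w"])
    then show ?thesis
      using cs r r' by (intro loc_frac_eqI) auto
  qed
  have "{loc_frac R S (v \<otimes> a \<oplus> u \<otimes> b) (u \<otimes> v) | a u b v.
      (a, u) \<in> loc_frac R S r s \<and> (b, v) \<in> loc_frac R S r' s'} = {loc_frac R S (s' \<otimes> r \<oplus> s \<otimes> r') (s \<otimes> s')}"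
    (is "?A = {?c}")
  proof
    show "?A \<subseteq> {?c}"
      using * by blast
    have "?c \<in> ?A"
      using loc_frac_self[OF r] loc_frac_self[OF r'] by blast
    then show "{?c} \<subseteq> ?A"
      by blast
  qed
  then show ?thesis
    by (simp add: localization_def)
qed

lemma loc_carrier: "carrier (localization R S) = {loc_frac R S r s | r s. r \<in> carrier R \<and> s \<in> S}"
  by (simp add: localization_def)

lemma loc_frac_closed:
  "r \<in> carrier R \<Longrightarrow> s \<in> S \<Longrightarrow> loc_frac R S r s \<in> carrier (localization R S)"
  by (auto simp: loc_carrier)

lemma loc_zero: "\<zero>\<^bsub>localization R S\<^esub> = loc_frac R S \<zero> \<one>"
  by (simp add: localization_def)

lemma loc_one: "\<one>\<^bsub>localization R S\<^esub> = loc_frac R S \<one> \<one>"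
  by (simp add: localization_def)

lemma loc_eqI:
  assumes "r \<in> carrier R" "s \<in> S" "r' \<in> carrier R" "s' \<in> S" "s' \<otimes> r = s \<otimes> r'"
  shows "loc_frac R S r s = loc_frac R S r' s'"
  using assms in_carr by (auto simp: loc_frac_eq_iff loc_rel_iff intro!: bexI[of _ \<one>])

lemma localization_cring: "cring (localization R S)"
proof (rule cringI)
  let ?L = "localization R S"
  show "abelian_group ?L"
  proof (rule abelian_groupI)
    fix x y z assume "x \<in> carrier ?L" "y \<in> carrier ?L" "z \<in> carrier ?L"
    then obtain a s b t c u where eq: "x = loc_frac R S a s" "y = loc_frac R S b t"
      "z = loc_frac R S c u"
      and m: "a \<in> carrier R" "b \<in> carrier R" "c \<in> carrier R" "s \<in> S" "t \<in> S" "u \<in> S"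
      unfolding loc_carrier by blast
    note cs = m m(4-6)[THEN in_carr]
    show "x \<oplus>\<^bsub>?L\<^esub> y \<oplus>\<^bsub>?L\<^esub> z = x \<oplus>\<^bsub>?L\<^esub> (y \<oplus>\<^bsub>?L\<^esub> z)"
      unfolding eq using cs by (simp add: loc_add) (rule loc_eqI; (use cs in \<open>simp; fail\<close>)?; use cs in algebra)
  next
    fix x y assume "x \<in> carrier ?L" "y \<in> carrier ?L"
    then obtain a s b t where eq: "x = loc_frac R S a s" "y = loc_frac R S b t"
      and m: "a \<in> carrier R" "b \<in> carrier R" "s \<in> S" "t \<in> S"
      unfolding loc_carrier by blast
    note cs = m m(3-4)[THEN in_carr]
    show "x \<oplus>\<^bsub>?L\<^esub> y \<in> carrier ?L"
      unfolding eq using cs by (simp add: loc_add loc_frac_closed)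
    show "x \<oplus>\<^bsub>?L\<^esub> y = y \<oplus>\<^bsub>?L\<^esub> x"
      unfolding eq using cs by (simp add: loc_add) (rule loc_eqI; (use cs in \<open>simp; fail\<close>)?; use cs in algebra)
  next
    show "\<zero>\<^bsub>?L\<^esub> \<in> carrier ?L"
      by (simp add: loc_zero loc_frac_closed)
  next
    fix x assume "x \<in> carrier ?L"
    then obtain a s where eq: "x = loc_frac R S a s" and m: "a \<in> carrier R" "s \<in> S"
      unfolding loc_carrier by blast
    note cs = m m(2)[THEN in_carr]
    show "\<zero>\<^bsub>?L\<^esub> \<oplus>\<^bsub>?L\<^esub> x = x"
      unfolding eq loc_zero using cs by (simp add: loc_add)
    have "loc_frac R S (\<ominus> a) s \<oplus>\<^bsub>?L\<^esub> x = \<zero>\<^bsub>?L\<^esub>"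
      unfolding eq loc_zero using cs by (simp add: loc_add) (rule loc_eqI; (use cs in \<open>simp; fail\<close>)?; use cs in algebra)
    then show "\<exists>y\<in>carrier ?L. y \<oplus>\<^bsub>?L\<^esub> x = \<zero>\<^bsub>?L\<^esub>"
      using m by (meson a_inv_closed loc_frac_closed)
  qed
  show "comm_monoid ?L"
  proof (rule comm_monoidI)
    fix x y z assume "x \<in> carrier ?L" "y \<in> carrier ?L" "z \<in> carrier ?L"
    then obtain a s b t c u where eq: "x = loc_frac R S a s" "y = loc_frac R S b t"
      "z = loc_frac R S c u"
      and m: "a \<in> carrier R" "b \<in> carrier R" "c \<in> carrier R" "s \<in> S" "t \<in> S" "u \<in> S"
      unfolding loc_carrier by blast
    note cs = m m(4-6)[THEN in_carr]
    show "x \<otimes>\<^bsub>?L\<^esub> y \<otimes>\<^bsub>?L\<^esub> z = x \<otimes>\<^bsub>?L\<^esub> (y \<otimes>\<^bsub>?L\<^esub> z)"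
      unfolding eq using cs by (simp add: loc_mult m_assoc)
  next
    fix x y assume "x \<in> carrier ?L" "y \<in> carrier ?L"
    then obtain a s b t where eq: "x = loc_frac R S a s" "y = loc_frac R S b t"
      and m: "a \<in> carrier R" "b \<in> carrier R" "s \<in> S" "t \<in> S"
      unfolding loc_carrier by blast
    note cs = m m(3-4)[THEN in_carr]
    show "x \<otimes>\<^bsub>?L\<^esub> y \<in> carrier ?L"
      unfolding eq using cs by (simp add: loc_mult loc_frac_closed)
    show "x \<otimes>\<^bsub>?L\<^esub> y = y \<otimes>\<^bsub>?L\<^esub> x"
      unfolding eq using cs by (simp add: loc_mult m_comm)
  next
    show "\<one>\<^bsub>?L\<^esub> \<in> carrier ?L"
      by (simp add: loc_one loc_frac_closed)
  next
    fix x assume "x \<in> carrier ?L"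
    then obtain a s where eq: "x = loc_frac R S a s" and m: "a \<in> carrier R" "s \<in> S"
      unfolding loc_carrier by blast
    note cs = m m(2)[THEN in_carr]
    show "\<one>\<^bsub>?L\<^esub> \<otimes>\<^bsub>?L\<^esub> x = x"
      unfolding eq loc_one using cs by (simp add: loc_mult)
  qed
  fix x y z assume "x \<in> carrier ?L" "y \<in> carrier ?L" "z \<in> carrier ?L"
  then obtain a s b t c u where eq: "x = loc_frac R S a s" "y = loc_frac R S b t"
    "z = loc_frac R S c u"
    and m: "a \<in> carrier R" "b \<in> carrier R" "c \<in> carrier R" "s \<in> S" "t \<in> S" "u \<in> S"
    unfolding loc_carrier by blast
  note cs = m m(4-6)[THEN in_carr]
  show "(x \<oplus>\<^bsub>?L\<^esub> y) \<otimes>\<^bsub>?L\<^esub> z = x \<otimes>\<^bsub>?L\<^esub> z \<oplus>\<^bsub>?L\<^esub> y \<otimes>\<^bsub>?L\<^esub> z"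
    unfolding eq using cs by (simp add: loc_add loc_mult) (rule loc_eqI; (use cs in \<open>simp; fail\<close>)?; use cs in algebra)
qed

end


section \<open>Tight closure\<close>

text \<open>In the definitions of this section \<open>p\<close> is meant to be the (prime) characteristic of \<open>R\<close>.\<close>

definition frobenius_power :: "('a, 'b) ring_scheme \<Rightarrow> nat \<Rightarrow> nat \<Rightarrow> 'a set \<Rightarrow> 'a set"
  where "frobenius_power R p n B = Idl\<^bsub>R\<^esub> {b [^]\<^bsub>R\<^esub> (p ^ n) | b. b \<in> B}"

definition tight_closure :: "('a, 'b) ring_scheme \<Rightarrow> nat \<Rightarrow> 'a set \<Rightarrow> 'a set"
  where "tight_closure R p B = {r \<in> carrier R. \<exists>d\<in>ring_circ R. \<exists>n0. \<forall>n\<ge>n0.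
    d \<otimes>\<^bsub>R\<^esub> (r [^]\<^bsub>R\<^esub> (p ^ n)) \<in> frobenius_power R p n B}"

definition test_element_for_ideals :: "('a, 'b) ring_scheme \<Rightarrow> nat \<Rightarrow> 'a \<Rightarrow> bool"
  where "test_element_for_ideals R p c \<longleftrightarrow> c \<in> ring_circ R \<and>
    (\<forall>B. ideal B R \<longrightarrow> (\<forall>r\<in>tight_closure R p B. \<forall>n.
      c \<otimes>\<^bsub>R\<^esub> (r [^]\<^bsub>R\<^esub> (p ^ n)) \<in> frobenius_power R p n B))"

end

theory Submission
  imports Defs
begin

text \<open>The idea is to test the zero ideal. If \<open>x\<close> is nilpotent, then \<open>x\<^sup>q = 0\<close> for every
  sufficiently large power \<open>q\<close> of \<open>p\<close>, so \<open>x\<close> lies in the tight closure of \<open>0\<close> with multiplier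
  \<open>1\<close>. As a test element works for all exponents, the exponent \<open>n = 0\<close> gives \<open>c x = 0\<close>:
  the test element annihilates the nilradical (\<open>test_element_annihilates_nilpotents\<close>).

  Let \<open>P\<close> be a minimal prime and \<open>r \<in> P\<close>. Minimality makes \<open>r\<close> nilpotent after localizing at \<open>P\<close>,
  that is, \<open>s r\<^sup>m = 0\<close> for some \<open>s \<notin> P\<close> (\<open>minimal_prime_ideal_locally_nilpotent\<close>). Hence
  \<open>s r\<close> is nilpotent in \<open>R\<close> and \<open>(c s) r = 0\<close>. Since \<open>c\<close> lies outside every minimal prime,
  \<open>c s \<notin> P\<close>, so the image of \<open>r\<close> in the localization vanishes. The maximal ideal of the
  local ring at \<open>P\<close> is therefore zero, which makes it a field.\<close>

text \<open>This is Krull's theorem: an ideal that is maximal among those disjoint from \<open>S\<close> is prime,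
  because enlarging it by either of two elements \<open>a\<close> and \<open>b\<close> produces elements of \<open>S\<close>, and the
  product of these lies in the ideal as soon as \<open>a b\<close> does.\<close>

lemma (in mult_closed) ex_primeideal_disjoint:
  assumes "\<zero> \<notin> S"
  shows "\<exists>Q. primeideal Q R \<and> Q \<inter> S = {}"
proof -
  define A where "A = {I. ideal I R \<and> I \<inter> S = {}}"
  have "\<exists>M\<in>A. \<forall>X\<in>A. M \<subseteq> X \<longrightarrow> X = M"
  proof (rule subset_Zorn_nonempty)
    show "A \<noteq> {}"
      using zeroideal assms unfolding A_def by blast
  next
    fix C assume C: "C \<noteq> {}" "subset.chain A C"
    then have CA: "C \<subseteq> A" and "subset.chain {I. ideal I R} C"
      unfolding A_def pred_on.chain_def by blast+
    then have "ideal (\<Union>C) R"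
      using chain_Union_is_ideal[of C] C(1) by presburger
    then show "\<Union>C \<in> A"
      using CA unfolding A_def by blast
  qed
  then obtain M where MA: "M \<in> A" and max_A: "\<forall>X\<in>A. M \<subseteq> X \<longrightarrow> X = M"
    by blast
  have M: "ideal M R" "M \<inter> S = {}"
    using MA by (simp_all add: A_def)
  have max: "X = M" if "ideal X R" "X \<inter> S = {}" "M \<subseteq> X" for X
    using max_A that by (simp add: A_def)
  interpret M: ideal M R by (rule M(1))
  have meets: "\<exists>m\<in>M. \<exists>x\<in>carrier R. m \<oplus> x \<otimes> a \<in> S" if a: "a \<in> carrier R" "a \<notin> M" for a
  proof -
    let ?X = "M <+>\<^bsub>R\<^esub> PIdl a"
    have "ideal ?X R"
      using a M by (intro add_ideals cgenideal_ideal)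
    moreover have "M \<subseteq> ?X"
    proof
      fix m assume m: "m \<in> M"
      then have "m = m \<oplus> \<zero> \<otimes> a"
        using a by simp
      then show "m \<in> ?X"
        unfolding set_add_def' cgenideal_def using m by blast
    qed
    moreover have "a \<in> ?X"
    proof -
      have "a = \<zero> \<oplus> \<one> \<otimes> a"
        using a by simp
      then show ?thesis
        unfolding set_add_def' cgenideal_def using M.zero_closed by blast
    qed
    ultimately have "?X \<inter> S \<noteq> {}"
      using max[of ?X] a by blast
    then show ?thesis
      unfolding set_add_def' cgenideal_def by blast
  qed
  have "primeideal M R"
  proof (rule primeidealI)
    show "carrier R \<noteq> M"
      using M one_closed by auto
    fix a b assume ab: "a \<in> carrier R" "b \<in> carrier R" "a \<otimes> b \<in> M"
    show "a \<in> M \<or> b \<in> M"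
    proof (rule ccontr)
      assume "\<not> (a \<in> M \<or> b \<in> M)"
      then obtain m x n y where m: "m \<in> M" "x \<in> carrier R" "m \<oplus> x \<otimes> a \<in> S"
        and n: "n \<in> M" "y \<in> carrier R" "n \<oplus> y \<otimes> b \<in> S"
        using meets ab by meson
      have "(m \<oplus> x \<otimes> a) \<otimes> (n \<oplus> y \<otimes> b) =
          m \<otimes> (n \<oplus> y \<otimes> b) \<oplus> ((x \<otimes> a) \<otimes> n \<oplus> (x \<otimes> y) \<otimes> (a \<otimes> b))"
        using m(1,2) n(1,2) ab(1,2) M.Icarr by algebra
      also have "\<dots> \<in> M"
        using m(1,2) n(1,2) ab in_carr[OF n(3)]
        by (simp add: M.a_closed M.I_l_closed M.I_r_closed)
      finally show False
        using m_closed[OF m(3) n(3)] M(2) by blast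
    qed
  qed (use M is_cring in auto)
  then show ?thesis
    using M by blast
qed

text \<open>If no product \<open>s r\<^sup>m\<close> with \<open>s \<notin> P\<close> vanishes, these products form a multiplicative set that
  avoids \<open>0\<close>. A prime disjoint from it misses both the complement of \<open>P\<close> and \<open>r\<close>, so it lies
  properly inside \<open>P\<close>, against minimality.\<close>

lemma (in cring) minimal_prime_ideal_locally_nilpotent:
  assumes P: "minimal_prime_ideal P R" and r: "r \<in> P"
  shows "\<exists>s\<in>carrier R - P. \<exists>m::nat. s \<otimes> r [^] m = \<zero>"
proof (rule ccontr)
  assume contr: "\<not> ?thesis"
  interpret P: primeideal P R
    using P by (simp add: minimal_prime_ideal_def)
  have rc: "r \<in> carrier R"
    using r P.Icarr by blast
  define S where "S = {s \<otimes> r [^] m | s (m::nat). s \<in> carrier R - P}"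
  interpret C: submonoid "carrier R - P" R
    by (rule P.compl_submonoid)
  have mem: "s \<in> S" if "s \<in> carrier R - P" for s
  proof -
    have "s = s \<otimes> r [^] (0::nat)"
      using that by simp
    then show ?thesis
      unfolding S_def using that by blast
  qed
  interpret S: mult_closed S R
  proof unfold_locales
    show "S \<subseteq> carrier R"
      using rc by (auto simp: S_def)
    show "\<one> \<in> S"
      using mem C.one_closed by blast
    fix x y assume "x \<in> S" "y \<in> S"
    then obtain s t and m n :: nat where xy: "x = s \<otimes> r [^] m" "y = t \<otimes> r [^] n"
      and st: "s \<in> carrier R - P" "t \<in> carrier R - P"
      unfolding S_def by blast
    have "x \<otimes> y = (s \<otimes> t) \<otimes> (r [^] m \<otimes> r [^] n)"
      unfolding xy using st rc by (simp add: m_ac)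
    also have "\<dots> = (s \<otimes> t) \<otimes> r [^] (m + n)"
      using rc by (simp add: nat_pow_mult)
    finally show "x \<otimes> y \<in> S"
      unfolding S_def using C.m_closed[OF st] by blast
  qed
  have "\<zero> \<notin> S"
    using contr unfolding S_def by force
  then obtain Q where Q: "primeideal Q R" "Q \<inter> S = {}"
    using S.ex_primeideal_disjoint by blast
  interpret Q: primeideal Q R by (rule Q(1))
  have "Q \<subseteq> P"
    using mem Q.Icarr Q(2) by blast
  then have "Q = P"
    using P Q(1) by (simp add: minimal_prime_ideal_def)
  moreover have "r \<in> S"
  proof -
    have "r = \<one> \<otimes> r [^] (1::nat)"
      using rc by simp
    then show ?thesis
      unfolding S_def using C.one_closed by blast
  qed
  ultimately show False
    using r Q(2) by blast
qed

lemma (in ring) frobenius_power_zero: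
  assumes "p > 0"
  shows "frobenius_power R p n {\<zero>} = {\<zero>}"
  using assms by (simp add: frobenius_power_def nat_pow_zero genideal_zero)

lemma (in cring) one_in_ring_circ: "\<one> \<in> ring_circ R"
proof -
  have "\<one> \<notin> P" if "minimal_prime_ideal P R" for P
  proof -
    interpret primeideal P R
      using that by (simp add: minimal_prime_ideal_def)
    show ?thesis
      using one_imp_carrier I_notcarr by blast
  qed
  then show ?thesis
    by (auto simp: ring_circ_def)
qed

lemma (in cring) nilpotent_in_tight_closure_zero:
  assumes "p > 1" and x: "x \<in> carrier R" and m: "x [^] (m::nat) = \<zero>"
  shows "x \<in> tight_closure R p {\<zero>}"
proof -
  have "\<one> \<otimes> x [^] (p ^ n) \<in> frobenius_power R p n {\<zero>}" if "n \<ge> m" for n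
  proof -
    have "m \<le> p ^ n"
      using that power_gt_expt[of p n] assms(1) by simp
    then have "x [^] (p ^ n) = x [^] m \<otimes> x [^] (p ^ n - m)"
      using x by (simp add: nat_pow_mult)
    also have "\<dots> = \<zero>"
      using x m by simp
    finally show ?thesis
      using assms(1) by (simp add: frobenius_power_zero)
  qed
  then show ?thesis
    unfolding tight_closure_def using x one_in_ring_circ by blast
qed

lemma (in cring) test_element_annihilates_nilpotents:
  assumes "p > 1" "test_element_for_ideals R p c"
    and x: "x \<in> carrier R" "x [^] (m::nat) = \<zero>"
  shows "c \<otimes> x = \<zero>"
proof -
  have "x \<in> tight_closure R p {\<zero>}"
    using assms by (intro nilpotent_in_tight_closure_zero)
  then have "c \<otimes> x [^] (p ^ 0) \<in> frobenius_power R p 0 {\<zero>}"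
    using assms(2) zeroideal unfolding test_element_for_ideals_def by blast
  then show ?thesis
    using assms(1) x by (simp add: frobenius_power_zero)
qed

text \<open>The maximal ideal of the local ring at \<open>P\<close> consists of the fractions with numerator in \<open>P\<close>.
  The second hypothesis says that all of these are zero.\<close>

lemma (in cring) field_localization_atI:
  assumes P: "primeideal P R"
    and killed: "\<And>r. r \<in> P \<Longrightarrow> \<exists>s\<in>carrier R - P. s \<otimes> r = \<zero>"
  shows "field (localization_at R P)"
proof -
  let ?S = "carrier R - P"
  let ?L = "localization R ?S"
  interpret P: primeideal P R by (rule P)
  interpret mult_closed ?S R
    by (intro mult_closed.intro is_cring P.compl_submonoid)
  have one: "\<one> \<in> ?S"
    by (rule one_closed)
  show ?thesis
    unfolding localization_at_def
  proof (rule cring.cring_fieldI2[OF localization_cring])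
    show "\<zero>\<^bsub>?L\<^esub> \<noteq> \<one>\<^bsub>?L\<^esub>"
    proof
      assume "\<zero>\<^bsub>?L\<^esub> = \<one>\<^bsub>?L\<^esub>"
      then obtain t where "t \<in> ?S" "t \<otimes> (\<one> \<otimes> \<one> \<ominus> \<one> \<otimes> \<zero>) = \<zero>"
        using one loc_frac_eq_iff[of \<one> \<one> \<zero> \<one>] by (auto simp: loc_zero loc_one)
      then have "\<zero> \<in> ?S"
        by (simp add: minus_eq)
      then show False
        using P.zero_closed by blast
    qed
  next
    fix A assume A: "A \<in> carrier ?L" "A \<noteq> \<zero>\<^bsub>?L\<^esub>"
    then obtain r s where eq: "A = loc_frac R ?S r s" and rs: "r \<in> carrier R" "s \<in> ?S"
      unfolding loc_carrier by blast
    have "r \<notin> P"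
    proof
      assume "r \<in> P"
      then obtain t where t: "t \<in> ?S" "t \<otimes> r = \<zero>"
        using killed by blast
      then have "t \<otimes> (\<one> \<otimes> r \<ominus> s \<otimes> \<zero>) = \<zero>"
        using rs by (simp add: minus_eq)
      then have "A = \<zero>\<^bsub>?L\<^esub>"
        unfolding eq loc_zero using rs one t by (subst loc_frac_eq_iff) blast+
      then show False
        using A by blast
    qed
    then have r: "r \<in> ?S"
      using rs by blast
    have "A \<otimes>\<^bsub>?L\<^esub> loc_frac R ?S s r = loc_frac R ?S (r \<otimes> s) (s \<otimes> r)"
      unfolding eq using rs r by (intro loc_mult) auto
    also have "\<dots> = \<one>\<^bsub>?L\<^esub>"
      unfolding loc_one
    proof (rule loc_eqI)
      show "s \<otimes> r \<in> ?S"
        using rs r by (intro m_closed)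
      show "\<one> \<otimes> (r \<otimes> s) = s \<otimes> r \<otimes> \<one>"
        using rs by (simp add: m_comm)
    qed (use rs one in auto)
    finally show "\<exists>b\<in>carrier ?L. A \<otimes>\<^bsub>?L\<^esub> b = \<one>\<^bsub>?L\<^esub>"
      using loc_frac_closed[of s r] rs r by blast
  qed
qed

theorem lemma0p4:
  fixes R :: "('a, 'b) ring_scheme" and p :: nat and c :: 'a
  assumes "cring R"
    and "noetherian_ring R"
    and "Factorial_Ring.prime p"
    and "ring_characteristic R = p"
    and "test_element_for_ideals R p c"
  shows "\<forall>P. minimal_prime_ideal P R \<longrightarrow> field (localization_at R P)"
proof (intro allI impI)
  fix P assume min: "minimal_prime_ideal P R"
  interpret cring R by (rule assms(1))
  interpret P: primeideal P R
    using min by (simp add: minimal_prime_ideal_def)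
  have c: "c \<in> carrier R - P"
    using assms(5) min by (auto simp: test_element_for_ideals_def ring_circ_def)
  show "field (localization_at R P)"
  proof (rule field_localization_atI)
    fix r assume r: "r \<in> P"
    then have rc: "r \<in> carrier R"
      by (rule P.Icarr)
    obtain s and m :: nat where s: "s \<in> carrier R - P" and m: "s \<otimes>\<^bsub>R\<^esub> r [^]\<^bsub>R\<^esub> m = \<zero>\<^bsub>R\<^esub>"
      using minimal_prime_ideal_locally_nilpotent[OF min r] by blast
    \<comment> \<open>With exponent \<open>m\<close> the factor \<open>s\<close> would be missing when \<open>m = 0\<close>.\<close>
    have "(s \<otimes>\<^bsub>R\<^esub> r) [^]\<^bsub>R\<^esub> Suc m = (s \<otimes>\<^bsub>R\<^esub> r [^]\<^bsub>R\<^esub> m) \<otimes>\<^bsub>R\<^esub> (s [^]\<^bsub>R\<^esub> m \<otimes>\<^bsub>R\<^esub> r)"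
      using s rc by (simp add: nat_pow_distrib m_ac)
    also have "\<dots> = \<zero>\<^bsub>R\<^esub>"
      using s rc m by simp
    finally have "c \<otimes>\<^bsub>R\<^esub> (s \<otimes>\<^bsub>R\<^esub> r) = \<zero>\<^bsub>R\<^esub>"
      using s rc by (intro test_element_annihilates_nilpotents[OF prime_gt_1_nat[OF assms(3)] assms(5)]) blast+
    then have "(c \<otimes>\<^bsub>R\<^esub> s) \<otimes>\<^bsub>R\<^esub> r = \<zero>\<^bsub>R\<^esub>"
      using c s rc by (simp add: m_assoc)
    moreover have "c \<otimes>\<^bsub>R\<^esub> s \<in> carrier R - P"
      using c s P.I_prime by auto
    ultimately show "\<exists>t\<in>carrier R - P. t \<otimes>\<^bsub>R\<^esub> r = \<zero>\<^bsub>R\<^esub>"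
      by blast
  qed (rule P.primeideal_axioms)
qed

end
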